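(* Fix a numerical semigroup $S=\langle n_1,\ldots,n_k\rangle$ with minimal generating set $n_1,\ldots,n_k$, and a finite presentation $\rho=\{(\mathbf{t}_1,\mathbf{t}_1'),\ldots,(\mathbf{t}_r,\mathbf{t}_r')\}$ of $S$. For each $(\mathbf{t}_i,\mathbf{t}_i')\in\rho$, let $\beta_i=\varphi(\mathbf{t}_i)$. If $n\in S$ with $n\ge\max(\beta_1,\ldots,\beta_r)$, then the number of edges in the trade graph $\mathrm{T}_{S,\rho}(n)$ is given by $$|E(\mathrm{T}_{S,\rho}(n))|=\sum_{i=1}^r|\mathsf{Z}_S(n-\beta_i)|.$$ In particular, $|E(\mathrm{T}_{S,\rho}(n))|$ coincides for large $n$ with a quasipolynomial of degree $k-1$ with leading coefficient (the coefficient of $n^{k-1}$ for $n$ divisible by $c$) $$\frac{c\,|\rho|}{(k-1)!\,n_1\cdots n_k}$$ and period dividing $\operatorname{lcm}(n_1,\ldots,n_k)$, where $c=\gcd(n_1,\ldots,n_k)$.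
   Context: For positive integers $n_1,\ldots,n_k$, the numerical semigroup they generate is $S=\langle n_1,\ldots,n_k\rangle=\{z_1n_1+\cdots+z_kn_k : z_i\in\mathbb{Z}_{\ge 0}\}$; the generators are not required to be relatively prime. The generating set is minimal if no proper subset generates the same set $S$. The factorization homomorphism is $\varphi:\mathbb{Z}_{\ge 0}^k\to S$, $\varphi(z_1,\ldots,z_k)=z_1n_1+\cdots+z_kn_k$, and the set of factorizations of $n$ is $\mathsf{Z}_S(n)=\{\mathbf{z}\in\mathbb{Z}_{\ge 0}^k:\varphi(\mathbf{z})=n\}$ (empty if $n\notin S$). Set $\ker\varphi=\{(\mathbf{z},\mathbf{z}')\in\mathbb{Z}_{\ge 0}^k\times\mathbb{Z}_{\ge 0}^k:\varphi(\mathbf{z})=\varphi(\mathbf{z}')\}$; its elements are called trades. For $\mathbf{z},\mathbf{z}'\in\mathsf{Z}_S(n)$, $\gcd(\mathbf{z},\mathbf{z}')=(\min(z_1,z_1'),\ldots,\min(z_k,z_k'))$, and the direct trade between $\mathbf{z}$ and $\mathbf{z}'$ is $(\mathbf{z}-\gcd(\mathbf{z},\mathbf{z}'),\mathbf{z}'-\gcd(\mathbf{z},\mathbf{z}'))$. A presentation of $S$ is a set $\rho\subseteq\ker\varphi$ such that for each $n\in S$ and any $\mathbf{z},\mathbf{z}'\in\mathsf{Z}_S(n)$ there is a sequence $\mathbf{w}_0,\ldots,\mathbf{w}_m\in\mathsf{Z}_S(n)$ with $\mathbf{w}_0=\mathbf{z}$, $\mathbf{w}_m=\mathbf{z}'$,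 and, for each $i$, at least one of the direct trade between $\mathbf{w}_i$ and $\mathbf{w}_{i+1}$ and the direct trade between $\mathbf{w}_{i+1}$ and $\mathbf{w}_i$ lying in $\rho$. The trade graph $\mathrm{T}_{S,\rho}(n)$ of $n$ with respect to $\rho$ is the simple graph with vertex set $\mathsf{Z}_S(n)$ and an edge connecting two vertices $\mathbf{z}$ and $\mathbf{z}'$ whenever the direct trade between $\mathbf{z}$ and $\mathbf{z}'$ (in one of the two orders) lies in $\rho$; $E(\cdot)$ denotes the edge set. A function $f:\mathbb{Z}_{\ge 0}\to\mathbb{R}$ is a quasipolynomial of degree $d$ if there are periodic functions $a_0,\ldots,a_d:\mathbb{Z}_{\ge 0}\to\mathbb{R}$, with $a_d$ not identically $0$, such that $f(n)=a_d(n)n^d+\cdots+a_1(n)n+a_0(n)$; its period is the minimal positive integer $p$ with $a_i(n+p)=a_i(n)$ for all $0\le i\le d$.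
   Formalization: The presentation ρ is assumed to consist of direct trades (t, t′ with disjoint supports), each in only one orientation and with t ≠ t′; the quasipolynomial part is stated for k ≥ 2, since for k = 1 there are no edges and the zero function has no degree 0. *)

theory Defs
  imports Complex_Main "HOL-Library.Cardinality"
begin

text \<open>
  The generators \<open>n\<^sub>1, \<dots>, n\<^sub>k\<close> are a family \<open>g\<close> indexed by a finite type \<open>'k\<close>, so \<open>k\<close> is
  \<open>CARD('k)\<close> (in particular \<open>k \<ge> 1\<close>), and vectors of \<open>k\<close> nonnegative integers are
  functions \<open>'k \<Rightarrow> nat\<close>.
\<close>

type_synonym 'k trade = "('k \<Rightarrow> nat) \<times> ('k \<Rightarrow> nat)"

definition semigroup_gen :: "('k::finite \<Rightarrow> nat) \<Rightarrow> 'k set \<Rightarrow> nat set" where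
  "semigroup_gen g J = {\<Sum>i\<in>J. z i * g i | z. True}"

abbreviation num_semigroup :: "('k::finite \<Rightarrow> nat) \<Rightarrow> nat set" where
  "num_semigroup g \<equiv> semigroup_gen g UNIV"

text \<open>
  Proper subfamilies are taken over index sets, so a minimal family is automatically
  repetition-free, as a listing \<open>n\<^sub>1, \<dots>, n\<^sub>k\<close> of the elements of a set is.
\<close>

definition minimal_generators :: "('k::finite \<Rightarrow> nat) \<Rightarrow> bool" where
  "minimal_generators g \<longleftrightarrow> (\<forall>J. J \<subset> UNIV \<longrightarrow> semigroup_gen g J \<noteq> num_semigroup g)"

definition fact_hom :: "('k::finite \<Rightarrow> nat) \<Rightarrow> ('k \<Rightarrow> nat) \<Rightarrow> nat" where
  "fact_hom g z = (\<Sum>i\<in>UNIV. z i * g i)"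

definition factorizations :: "('k::finite \<Rightarrow> nat) \<Rightarrow> nat \<Rightarrow> ('k \<Rightarrow> nat) set" where
  "factorizations g n = {z. fact_hom g z = n}"

definition fact_kernel :: "('k::finite \<Rightarrow> nat) \<Rightarrow> 'k trade set" where
  "fact_kernel g = {(z, z'). fact_hom g z = fact_hom g z'}"

definition vec_gcd :: "('k \<Rightarrow> nat) \<Rightarrow> ('k \<Rightarrow> nat) \<Rightarrow> 'k \<Rightarrow> nat" where
  "vec_gcd z z' = (\<lambda>i. min (z i) (z' i))"

definition direct_trade :: "('k \<Rightarrow> nat) \<Rightarrow> ('k \<Rightarrow> nat) \<Rightarrow> 'k trade" where
  "direct_trade z z' = ((\<lambda>i. z i - vec_gcd z z' i), (\<lambda>i. z' i - vec_gcd z z' i))"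

definition presentation :: "('k::finite \<Rightarrow> nat) \<Rightarrow> 'k trade set \<Rightarrow> bool" where
  "presentation g \<rho> \<longleftrightarrow>
     \<rho> \<subseteq> fact_kernel g \<and>
     (\<forall>n\<in>num_semigroup g. \<forall>z\<in>factorizations g n. \<forall>z'\<in>factorizations g n.
        \<exists>m w. w 0 = z \<and> w m = z' \<and> (\<forall>i\<le>m. w i \<in> factorizations g n) \<and>
          (\<forall>i<m. direct_trade (w i) (w (Suc i)) \<in> \<rho> \<or> direct_trade (w (Suc i)) (w i) \<in> \<rho>))"

text \<open>
  Trades with common support, trivial trades \<open>(t, t)\<close> and a second orientation of a trade
  contribute no further edges to a trade graph.  Since the edge count charges every element of
  \<open>\<rho>\<close> with its own edges, \<open>\<rho>\<close> has to be free of them; the condition \<open>(t', t) \<notin> \<rho>\<close> also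
  excludes \<open>t = t'\<close>.
\<close>

definition irredundant_trades :: "'k trade set \<Rightarrow> bool" where
  "irredundant_trades \<rho> \<longleftrightarrow> (\<forall>(t, t')\<in>\<rho>. direct_trade t t' = (t, t') \<and> (t', t) \<notin> \<rho>)"

text \<open>A simple graph is a pair of a vertex set and a set of two-element sets of vertices.\<close>

definition trade_graph ::
  "('k::finite \<Rightarrow> nat) \<Rightarrow> 'k trade set \<Rightarrow> nat \<Rightarrow> ('k \<Rightarrow> nat) set \<times> ('k \<Rightarrow> nat) set set" where
  "trade_graph g \<rho> n =
     (factorizations g n,
      {{z, z'} | z z'. z \<in> factorizations g n \<and> z' \<in> factorizations g n \<and> z \<noteq> z' \<and>
         (direct_trade z z' \<in> \<rho> \<or> direct_trade z' z \<in> \<rho>)})"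

abbreviation edges :: "'v set \<times> 'v set set \<Rightarrow> 'v set set" where
  "edges G \<equiv> snd G"

definition is_periodic :: "(nat \<Rightarrow> real) \<Rightarrow> bool" where
  "is_periodic a \<longleftrightarrow> (\<exists>p>0. \<forall>n. a (n + p) = a n)"

text \<open>
  \<open>f\<close> is a quasipolynomial of degree \<open>d\<close> with coefficient functions \<open>a 0, \<dots>, a d\<close>; these
  are uniquely determined by \<open>f\<close> and \<open>d\<close>.
\<close>

definition quasipolynomial :: "(nat \<Rightarrow> real) \<Rightarrow> nat \<Rightarrow> (nat \<Rightarrow> nat \<Rightarrow> real) \<Rightarrow> bool" where
  "quasipolynomial f d a \<longleftrightarrow>
     (\<forall>i\<le>d. is_periodic (a i)) \<and> (\<exists>n. a d n \<noteq> 0) \<and>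
     (\<forall>n. f n = (\<Sum>i\<le>d. a i n * real n ^ i))"

definition quasipolynomial_period :: "nat \<Rightarrow> (nat \<Rightarrow> nat \<Rightarrow> real) \<Rightarrow> nat" where
  "quasipolynomial_period d a = (LEAST p. 0 < p \<and> (\<forall>i\<le>d. \<forall>n. a i (n + p) = a i n))"

end

theory Submission
  imports Defs "HOL-Library.FuncSet" "HOL-Number_Theory.Cong" "HOL-Computational_Algebra.Polynomial"
begin

text \<open>
  A trade \<open>(t, t')\<close> with disjoint supports is the direct trade between \<open>z\<close> and \<open>z'\<close> exactly when
  \<open>z = t + u\<close> and \<open>z' = t' + u\<close> for a factorization \<open>u\<close> of \<open>n - \<phi>(t)\<close>, which gives the edge count.

  Let \<open>L = lcm(n\<^sub>1, \<dots>, n\<^sub>k)\<close>. Division with remainder of each \<open>z\<^sub>i\<close> by \<open>L / n\<^sub>i\<close> writes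
  \<open>\<phi>(z) = L (q\<^sub>1 + \<dots> + q\<^sub>k) + \<phi>(r)\<close> with \<open>r\<close> in the finite box of remainders. Hence the number of
  factorizations of a large \<open>n\<close> is the sum over those \<open>r\<close> in the box with \<open>\<phi>(r) \<equiv> n\<close> modulo \<open>L\<close>
  of the polynomial \<open>(m + k - 1 choose k - 1)\<close> in \<open>m = (n - \<phi>(r)) / L\<close>. The number of such \<open>r\<close> is
  the same for every \<open>n\<close> divisible by \<open>c\<close>, since translations of the box are injective, and
  equals \<open>c L\<^bsup>k-1\<^esup> / (n\<^sub>1 \<dots> n\<^sub>k)\<close>.
\<close>

section \<open>Counting edges\<close>

lemma fact_hom_add: "fact_hom g (\<lambda>i. x i + y i) = fact_hom g x + fact_hom g y"
  by (simp add: fact_hom_def algebra_simps sum.distrib)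

text \<open>The common part \<open>u\<close> is \<open>vec_gcd z z'\<close>. Conversely, minimum
  commutes with adding \<open>u\<close>, so a translate of a pair with disjoint supports has that
  pair as its direct trade.\<close>

lemma direct_trade_eq_iff:
  assumes "direct_trade t t' = (t, t')"
  shows "direct_trade z z' = (t, t') \<longleftrightarrow> (\<exists>u. z = (\<lambda>i. t i + u i) \<and> z' = (\<lambda>i. t' i + u i))"
proof
  assume "direct_trade z z' = (t, t')"
  then have "z = (\<lambda>i. t i + vec_gcd z z' i) \<and> z' = (\<lambda>i. t' i + vec_gcd z z' i)"
    by (auto simp: direct_trade_def vec_gcd_def)
  then show "\<exists>u. z = (\<lambda>i. t i + u i) \<and> z' = (\<lambda>i. t' i + u i)" by blast
next
  assume "\<exists>u. z = (\<lambda>i. t i + u i) \<and> z' = (\<lambda>i. t' i + u i)"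
  then show "direct_trade z z' = (t, t')"
    using assms by (auto simp: direct_trade_def vec_gcd_def fun_eq_iff simp flip: min_add_distrib_left)
qed

lemma finite_factorizations:
  assumes "\<And>i. 0 < g i"
  shows "finite (factorizations g n)"
proof (rule finite_subset)
  show "factorizations g n \<subseteq> Pi\<^sub>E UNIV (\<lambda>_. {..n})"
  proof
    fix z assume "z \<in> factorizations g n"
    then have n: "(\<Sum>i\<in>UNIV. z i * g i) = n"
      by (simp add: factorizations_def fact_hom_def)
    have "z i \<le> n" for i
    proof -
      have "z i \<le> z i * g i" using assms[of i] by simp
      also have "\<dots> \<le> (\<Sum>i\<in>UNIV. z i * g i)" by (rule member_le_sum) auto
      finally show ?thesis using n by simp
    qed
    then show "z \<in> Pi\<^sub>E UNIV (\<lambda>_. {..n})" by auto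
  qed
qed (auto intro: finite_PiE)

text \<open>The map sending a trade \<open>(t, t')\<close> and a factorization \<open>u\<close> of n
  - \<phi>(t) to the edge {t + u, t' + u} is a bijection. Irredundancy makes it injective: the
  direct trade of an edge determines \<open>(t, t')\<close> up to orientation, and only one
  orientation lies in \<rho>.\<close>

lemma card_edges_trade_graph:
  assumes pos: "\<And>i. 0 < g i" and fin: "finite \<rho>" and ker: "\<rho> \<subseteq> fact_kernel g"
    and irr: "irredundant_trades \<rho>" and le: "\<forall>(t, t')\<in>\<rho>. fact_hom g t \<le> n"
  shows "card (edges (trade_graph g \<rho> n)) =
    (\<Sum>(t, t')\<in>\<rho>. card (factorizations g (n - fact_hom g t)))"
proof -
  define D where "D = Sigma \<rho> (\<lambda>(t, t'). factorizations g (n - fact_hom g t))"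
  define h where "h = (\<lambda>((t, t'), u). {\<lambda>i. t i + u i, \<lambda>i. t' i + u i} :: ('a \<Rightarrow> nat) set)"
  have dt: "direct_trade t t' = (t, t')" and nsym: "(t', t) \<notin> \<rho>" if "(t, t') \<in> \<rho>" for t t'
    using irr that by (auto simp: irredundant_trades_def)
  have hom: "fact_hom g t' = fact_hom g t" "fact_hom g t \<le> n" if "(t, t') \<in> \<rho>" for t t'
    using ker le that by (auto simp: fact_kernel_def)
  have dtu: "direct_trade (\<lambda>i. t i + u i) (\<lambda>i. t' i + u i) = (t, t')" if "(t, t') \<in> \<rho>" for t t' u
    using direct_trade_eq_iff[OF dt[OF that]] by blast
  \<comment> \<open>Surjectivity for one orientation; edges are unordered, so the other follows by
    swapping \<open>z\<close> and \<open>z'\<close>.\<close>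
  have edge: "\<exists>x\<in>D. h x = {z, z'}"
    if "z \<in> factorizations g n" "direct_trade z z' \<in> \<rho>" for z z'
  proof -
    obtain t t' where t: "direct_trade z z' = (t, t')" by fastforce
    with that have tr: "(t, t') \<in> \<rho>" by simp
    obtain u where u: "z = (\<lambda>i. t i + u i)" "z' = (\<lambda>i. t' i + u i)"
      using t direct_trade_eq_iff[OF dt[OF tr]] by blast
    have "fact_hom g u = n - fact_hom g t"
      using that(1) u by (simp add: factorizations_def fact_hom_add)
    then have "((t, t'), u) \<in> D" using tr by (simp add: D_def factorizations_def)
    moreover have "h ((t, t'), u) = {z, z'}" using u by (simp add: h_def)
    ultimately show ?thesis by blast
  qed
  have "bij_betw h D (edges (trade_graph g \<rho> n))"
    unfolding bij_betw_def
  proof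
    show "inj_on h D"
    proof (rule inj_onI)
      fix x y assume xy: "x \<in> D" "y \<in> D" "h x = h y"
      obtain t t' u where x: "x = ((t, t'), u)" by (metis surj_pair)
      obtain s s' v where y: "y = ((s, s'), v)" by (metis surj_pair)
      have tr: "(t, t') \<in> \<rho>" "(s, s') \<in> \<rho>" using xy x y by (auto simp: D_def)
      from xy x y have
        "(\<lambda>i. t i + u i) = (\<lambda>i. s i + v i) \<and> (\<lambda>i. t' i + u i) = (\<lambda>i. s' i + v i) \<or>
         (\<lambda>i. t i + u i) = (\<lambda>i. s' i + v i) \<and> (\<lambda>i. t' i + u i) = (\<lambda>i. s i + v i)"
        by (auto simp: h_def doubleton_eq_iff)
      then show "x = y"
      proof
        assume e: "(\<lambda>i. t i + u i) = (\<lambda>i. s i + v i) \<and> (\<lambda>i. t' i + u i) = (\<lambda>i. s' i + v i)"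
        then have "(t, t') = (s, s')" using dtu[OF tr(1), of u] dtu[OF tr(2), of v] by simp
        with e show ?thesis by (auto simp: x y fun_eq_iff)
      next
        \<comment> \<open>If the endpoints match crosswise, the two trades are reverses of each
          other, which irredundancy forbids.\<close>
        assume e: "(\<lambda>i. t i + u i) = (\<lambda>i. s' i + v i) \<and> (\<lambda>i. t' i + u i) = (\<lambda>i. s i + v i)"
        have "direct_trade a b = (c, d) \<Longrightarrow> direct_trade b a = (d, c)" for a b c d :: "'a \<Rightarrow> nat"
          by (auto simp: direct_trade_def vec_gcd_def min.commute)
        then have "(t', t) = (s, s')" using e dtu[OF tr(1), of u] dtu[OF tr(2), of v] by metis
        with tr nsym show ?thesis by blast
      qed
    qed
    show "h ` D = edges (trade_graph g \<rho> n)"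
    proof
      show "h ` D \<subseteq> edges (trade_graph g \<rho> n)"
      proof
        fix e assume "e \<in> h ` D"
        then obtain t t' u where tu: "(t, t') \<in> \<rho>" "fact_hom g u = n - fact_hom g t"
          and e: "e = {\<lambda>i. t i + u i, \<lambda>i. t' i + u i}"
          by (auto simp: D_def h_def factorizations_def)
        have "(\<lambda>i. t i + u i) \<in> factorizations g n" "(\<lambda>i. t' i + u i) \<in> factorizations g n"
          using hom[OF tu(1)] tu(2) by (auto simp: factorizations_def fact_hom_add)
        \<comment> \<open>No loops arise: equal endpoints would give t = t', and then
          \<open>(t', t)\<close> would lie in \<rho>.\<close>
        moreover have "(\<lambda>i. t i + u i) \<noteq> (\<lambda>i. t' i + u i)"
          using nsym[OF tu(1)] tu(1) by (metis add_right_cancel ext)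
        moreover have "direct_trade (\<lambda>i. t i + u i) (\<lambda>i. t' i + u i) \<in> \<rho>"
          using dtu[OF tu(1)] tu(1) by simp
        ultimately show "e \<in> edges (trade_graph g \<rho> n)"
          unfolding e trade_graph_def snd_conv by blast
      qed
      show "edges (trade_graph g \<rho> n) \<subseteq> h ` D"
      proof
        fix e assume "e \<in> edges (trade_graph g \<rho> n)"
        then obtain z z' where z: "e = {z, z'}" "z \<in> factorizations g n" "z' \<in> factorizations g n"
          "direct_trade z z' \<in> \<rho> \<or> direct_trade z' z \<in> \<rho>"
          by (auto simp: trade_graph_def)
        then show "e \<in> h ` D" using edge[of z z'] edge[of z' z] by (metis image_eqI insert_commute)
      qed
    qed
  qed
  then have "card (edges (trade_graph g \<rho> n)) = card D" by (simp add: bij_betw_same_card)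
  also have "\<dots> = (\<Sum>(t, t')\<in>\<rho>. card (factorizations g (n - fact_hom g t)))"
    unfolding D_def using fin finite_factorizations[OF pos]
    by (subst card_SigmaI) (auto simp: case_prod_beta intro!: sum.cong)
  finally show ?thesis .
qed

text \<open>For i \<noteq> j, the product \<open>g i * g j\<close> has two distinct factorizations,
  \<open>g j\<close> copies of \<open>g i\<close> and \<open>g i\<close> copies of
  \<open>g j\<close>; joining them takes at least one trade. This makes the leading coefficient
  nonzero.\<close>

lemma presentation_nonempty:
  fixes g :: "'k::finite \<Rightarrow> nat"
  assumes pos: "\<And>i. 0 < g i" and pres: "presentation g \<rho>" and k: "2 \<le> CARD('k)"
  shows "\<rho> \<noteq> {}"
proof
  assume emp: "\<rho> = {}"
  obtain i j :: 'k where ij: "i \<noteq> j"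
    using k by (metis card_2_iff' card_le_Suc0_iff_eq finite UNIV_I not_less_eq_eq numeral_2_eq_2)
  define z where "z = (\<lambda>l. if l = i then g j else 0)"
  define z' where "z' = (\<lambda>l. if l = j then g i else 0)"
  have hom: "fact_hom g z = g i * g j" "fact_hom g z' = g i * g j"
    by (simp_all add: fact_hom_def z_def z'_def if_distrib[of "\<lambda>x. x * _"] cong: if_cong)
  then have "g i * g j \<in> num_semigroup g" "z \<in> factorizations g (g i * g j)"
    "z' \<in> factorizations g (g i * g j)"
    unfolding factorizations_def semigroup_gen_def fact_hom_def by (force dest: sym)+
  then obtain m w where "w 0 = z" "w m = z'" and w: "\<forall>i<m. direct_trade (w i) (w (Suc i)) \<in> \<rho> \<or>
      direct_trade (w (Suc i)) (w i) \<in> \<rho>"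
    using pres unfolding presentation_def by meson
  moreover have "m = 0" using w emp by auto
  ultimately have "z i = z' i" by simp
  then show False using ij pos[of j] by (simp add: z_def z'_def)
qed

section \<open>Remainders modulo the least common multiple\<close>

definition residue_box :: "('k::finite \<Rightarrow> nat) \<Rightarrow> ('k \<Rightarrow> nat) set" where
  "residue_box g = {r. \<forall>i. r i < Lcm (range g) div g i}"

definition residue_class :: "('k::finite \<Rightarrow> nat) \<Rightarrow> nat \<Rightarrow> ('k \<Rightarrow> nat) set" where
  "residue_class g n = {r \<in> residue_box g. [fact_hom g r = n] (mod Lcm (range g))}"

lemma residue_box_PiE: "residue_box g = Pi\<^sub>E UNIV (\<lambda>i. {..<Lcm (range g) div g i})"
  by (auto simp: residue_box_def)

lemma finite_residue_box [simp]: "finite (residue_box g)"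
  by (simp add: residue_box_PiE finite_PiE)

lemma finite_residue_class [simp]: "finite (residue_class g n)"
  by (simp add: residue_class_def)

lemma card_residue_box: "card (residue_box g) = (\<Prod>i\<in>UNIV. Lcm (range g) div g i)"
  by (simp add: residue_box_PiE card_PiE)

lemma Gcd_dvd_fact_hom: "Gcd (range g) dvd fact_hom g z"
  unfolding fact_hom_def by (rule dvd_sum) (auto intro: dvd_mult)

context
  fixes g :: "'k::finite \<Rightarrow> nat"
  assumes pos: "\<And>i. 0 < g i"
begin

lemma Lcm_pos: "0 < Lcm (range g)"
proof -
  have "0 \<notin> range g" using pos by (metis imageE less_irrefl)
  then show ?thesis using Lcm_0_iff_nat[of "range g"] by (metis finite finite_imageI gr0I)
qed

lemma div_mult_gen: "Lcm (range g) div g i * g i = Lcm (range g)"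
  by simp

lemma div_gen_pos: "0 < Lcm (range g) div g i"
  using div_mult_gen[of i] Lcm_pos by (metis gr0I mult_0)

text \<open>Each coordinate contributes at most L. Hence the truncated subtraction n - \<phi>(r) is
  exact once n is at least k L.\<close>

lemma fact_hom_residue_box_le:
  assumes "r \<in> residue_box g"
  shows "fact_hom g r \<le> CARD('k) * Lcm (range g)"
proof -
  have "r i * g i \<le> Lcm (range g)" for i
  proof -
    have "r i \<le> Lcm (range g) div g i" using assms by (simp add: residue_box_def less_imp_le)
    then have "r i * g i \<le> Lcm (range g) div g i * g i" by (rule mult_le_mono1)
    then show ?thesis by (simp only: div_mult_gen)
  qed
  then have "fact_hom g r \<le> (\<Sum>i\<in>(UNIV::'k set). Lcm (range g))"
    unfolding fact_hom_def by (intro sum_mono) auto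
  then show ?thesis by simp
qed

text \<open>L div \<open>g i\<close> copies of the generator \<open>g i\<close> weigh exactly L,
  whatever i is, so the quotients enter only through their sum.\<close>

lemma fact_hom_div_mod:
  "fact_hom g (\<lambda>i. q i * (Lcm (range g) div g i) + r i) =
    Lcm (range g) * (\<Sum>i\<in>UNIV. q i) + fact_hom g r"
proof -
  have "q i * (Lcm (range g) div g i) * g i = Lcm (range g) * q i" for i
    using div_mult_gen[of i] by (metis mult.assoc mult.commute)
  then have "fact_hom g (\<lambda>i. q i * (Lcm (range g) div g i)) = Lcm (range g) * (\<Sum>i\<in>UNIV. q i)"
    unfolding fact_hom_def by (simp only: sum_distrib_left)
  then show ?thesis by (simp add: fact_hom_add)
qed

section \<open>Equal size of the nonempty residue classes\<close>

text \<open>Translation by \<open>z\<close> followed by coordinatewise reduction is an injection of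
  the box into itself, and the reduction changes the value of \<phi> only by a multiple of
  L.\<close>

lemma card_residue_class_mono: "card (residue_class g n) \<le> card (residue_class g (n + fact_hom g z))"
proof (rule card_inj_on_le)
  let ?M = "\<lambda>i. Lcm (range g) div g i"
  let ?f = "\<lambda>r i. (r i + z i) mod ?M i"
  show "inj_on ?f (residue_class g n)"
  proof (rule inj_onI)
    fix r s assume rs: "r \<in> residue_class g n" "s \<in> residue_class g n" "?f r = ?f s"
    have "r i = s i" for i
    proof -
      have "[r i + z i = s i + z i] (mod ?M i)" using fun_cong[OF rs(3), of i] by (simp add: cong_def)
      then have "[r i = s i] (mod ?M i)" by (simp add: cong_add_rcancel_nat)
      then show ?thesis using rs(1,2) by (simp add: residue_class_def residue_box_def cong_def)
    qed
    then show "r = s" by auto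
  qed
  show "?f ` residue_class g n \<subseteq> residue_class g (n + fact_hom g z)"
  proof
    fix s assume "s \<in> ?f ` residue_class g n"
    then obtain r where r: "r \<in> residue_class g n" and s: "s = ?f r" by blast
    have "(\<lambda>i. r i + z i) = (\<lambda>i. ((r i + z i) div ?M i) * ?M i + s i)"
      unfolding s by (intro ext) (rule div_mult_mod_eq[symmetric])
    then have "fact_hom g (\<lambda>i. r i + z i) =
        Lcm (range g) * (\<Sum>i\<in>UNIV. (r i + z i) div ?M i) + fact_hom g s"
      using fact_hom_div_mod[of "\<lambda>i. (r i + z i) div ?M i" s] by simp
    then have "[fact_hom g s = fact_hom g r + fact_hom g z] (mod Lcm (range g))"
      by (simp add: cong_def fact_hom_add)
    also have "[fact_hom g r + fact_hom g z = n + fact_hom g z] (mod Lcm (range g))"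
      using r by (simp add: residue_class_def cong_add_rcancel_nat)
    finally show "s \<in> residue_class g (n + fact_hom g z)"
      using div_gen_pos by (simp add: residue_class_def residue_box_def s)
  qed
qed simp

text \<open>Bezout's identity with nonnegative coefficients: modulo L, the factor L - 1 acts as -1.
  The proof adds one generator at a time.\<close>

lemma bezout_mod_Lcm: "\<exists>z. [fact_hom g z = Gcd (range g)] (mod Lcm (range g))"
proof -
  let ?L = "Lcm (range g)"
  have "\<exists>z. [(\<Sum>i\<in>J. z i * g i) = Gcd (g ` J)] (mod ?L)" if "finite J" for J
    using that
  proof induction
    case empty
    then show ?case by simp
  next
    case (insert i J)
    then obtain z where z: "[(\<Sum>i\<in>J. z i * g i) = Gcd (g ` J)] (mod ?L)" by blast
    obtain x y where xy: "g i * x = Gcd (g ` J) * y + gcd (g i) (Gcd (g ` J))"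
      using bezout_nat[of "g i" "Gcd (g ` J)"] pos[of i] by auto
    \<comment> \<open>The identity above calls for -y times the old combination; (L - 1) y is its
      nonnegative substitute.\<close>
    define v where "v = (\<lambda>j. if j = i then x else (?L - 1) * y * z j)"
    have "(\<Sum>j\<in>J. v j * g j) = (\<Sum>j\<in>J. (?L - 1) * y * (z j * g j))"
      using insert.hyps by (intro sum.cong) (auto simp: v_def algebra_simps)
    then have "(\<Sum>j\<in>insert i J. v j * g j) = x * g i + (?L - 1) * y * (\<Sum>j\<in>J. z j * g j)"
      using insert.hyps by (simp add: v_def sum_distrib_left)
    also have "[\<dots> = x * g i + (?L - 1) * y * Gcd (g ` J)] (mod ?L)"
      using z by (intro cong_add cong_mult) auto
    also have "x * g i + (?L - 1) * y * Gcd (g ` J) =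
        ((?L - 1) + 1) * (Gcd (g ` J) * y) + gcd (g i) (Gcd (g ` J))"
      using xy by (simp add: algebra_simps)
    also have "(?L - 1) + 1 = ?L" using Lcm_pos by simp
    also have "[?L * (Gcd (g ` J) * y) + gcd (g i) (Gcd (g ` J)) = gcd (g i) (Gcd (g ` J))] (mod ?L)"
      by (simp add: cong_def)
    finally show ?case by auto
  qed
  from this[of UNIV] show ?thesis by (simp add: fact_hom_def)
qed

lemma residue_class_cong:
  assumes "[m = n] (mod Lcm (range g))"
  shows "residue_class g m = residue_class g n"
  using assms by (auto simp: residue_class_def intro: cong_trans cong_sym)

text \<open>By the Bezout vector, a step from m to m + c never decreases the count. Modulo L these
  steps run in a cycle, so the count is constant along it.\<close>

lemma card_residue_class_const:
  assumes "Gcd (range g) dvd n"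
  shows "card (residue_class g n) = card (residue_class g 0)"
proof -
  let ?L = "Lcm (range g)" and ?c = "Gcd (range g)"
  obtain z where z: "[fact_hom g z = ?c] (mod ?L)" using bezout_mod_Lcm by blast
  have step: "card (residue_class g m) \<le> card (residue_class g (m + ?c))" for m
  proof -
    have "[m + fact_hom g z = m + ?c] (mod ?L)" using z by (simp add: cong_add_lcancel_nat)
    then show ?thesis using card_residue_class_mono[of m z] residue_class_cong by metis
  qed
  have mono: "card (residue_class g m) \<le> card (residue_class g (m + j * ?c))" for m j
  proof (induction j)
    case (Suc j)
    have "card (residue_class g (m + j * ?c)) \<le> card (residue_class g (m + Suc j * ?c))"
      using step[of "m + j * ?c"] by (simp add: algebra_simps)
    with Suc show ?case by linarith
  qed simp
  obtain j where j: "n = j * ?c" using assms by (metis dvdE mult.commute)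
  have "?c dvd ?L" by (meson Gcd_dvd dvd_Lcm dvd_trans rangeI)
  then obtain l where l: "?L = l * ?c" by (metis dvdE mult.commute)
  have "0 < l" using Lcm_pos l by (cases l) auto
  have le: "card (residue_class g 0) \<le> card (residue_class g n)" using mono[of 0 j] j by simp
  \<comment> \<open>From n = j c, a further j (l - 1) steps lead to j L, which is congruent to 0;
    this gives the reverse inequality.\<close>
  have "n + (j * (l - 1)) * ?c = j * ?L"
    using j l \<open>0 < l\<close> by (cases l) (auto simp: algebra_simps)
  moreover have "[j * ?L = 0] (mod ?L)" by (simp add: cong_def)
  ultimately have "card (residue_class g n) \<le> card (residue_class g 0)"
    using mono[of n "j * (l - 1)"] residue_class_cong by metis
  with le show ?thesis by simp
qed

text \<open>The box has L^k / (product of the generators) elements. They are spread evenly over the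
  L / c residues divisible by c, and no other residue occurs.\<close>

lemma card_residue_class:
  assumes "Gcd (range g) dvd n"
  shows "real (card (residue_class g n)) =
    real (Gcd (range g)) * real (Lcm (range g)) ^ (CARD('k) - 1) / (\<Prod>i\<in>UNIV. real (g i))"
proof -
  let ?L = "Lcm (range g)" and ?c = "Gcd (range g)" and ?N = "card (residue_class g 0)"
  have cL: "?c dvd ?L" by (meson Gcd_dvd dvd_Lcm dvd_trans rangeI)
  then obtain l where l: "?L = l * ?c" by (metis dvdE mult.commute)
  have lc: "0 < l" "0 < ?c" using Lcm_pos l by (metis gr0I mult_0 mult_0_right less_irrefl)+
  have "residue_box g = (\<Union>j<?L. residue_class g j)"
    using Lcm_pos by (auto simp: residue_class_def cong_def intro!: bexI[of _ "_ mod ?L"])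
  also have "card \<dots> = (\<Sum>j<?L. card (residue_class g j))"
    by (rule card_UN_disjoint) (auto simp: residue_class_def cong_def)
  also have "\<dots> = (\<Sum>j | j < ?L \<and> ?c dvd j. card (residue_class g j))"
  proof (rule sum.mono_neutral_right)
    \<comment> \<open>Since c divides both L and every value of \<phi>, a congruence modulo L forces
      c to divide j.\<close>
    have "residue_class g j = {}" if "\<not> ?c dvd j" for j
      using that Gcd_dvd_fact_hom[of g] cong_dvd_modulus_nat[OF _ cL] cong_dvd_iff
      unfolding residue_class_def by blast
    then show "\<forall>j\<in>{..<?L} - {j. j < ?L \<and> ?c dvd j}. card (residue_class g j) = 0" by auto
  qed auto
  also have "\<dots> = card {j. j < ?L \<and> ?c dvd j} * ?N"
  proof -
    have "(\<Sum>j | j < ?L \<and> ?c dvd j. card (residue_class g j)) = (\<Sum>j | j < ?L \<and> ?c dvd j. ?N)"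
      by (intro sum.cong refl) (auto intro: card_residue_class_const)
    then show ?thesis by simp
  qed
  also have "{j. j < ?L \<and> ?c dvd j} = (\<lambda>j. j * ?c) ` {..<l}"
    using l lc by (auto elim!: dvdE simp: mult.commute)
  also have "card \<dots> = l"
  proof -
    have "inj_on (\<lambda>j. j * ?c) {..<l}" using lc(2) by (metis inj_onI mult_cancel2 less_irrefl)
    then show ?thesis by (simp add: card_image)
  qed
  finally have "real (\<Prod>i\<in>UNIV. ?L div g i) = real l * real ?N"
    by (simp add: card_residue_box)
  moreover have "real (?L div g i) = real ?L / real (g i)" for i
    by (simp add: real_of_nat_div)
  ultimately have "real l * real ?N = real ?L ^ CARD('k) / (\<Prod>i\<in>UNIV. real (g i))"
    by (simp add: prod_dividef)
  also have "real ?L ^ CARD('k) = real l * real ?c * real ?L ^ (CARD('k) - 1)"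
    using power_minus_mult[OF zero_less_card_finite[where 'a = 'k], of "real ?L"]
      arg_cong[OF l, of real] by (simp only: of_nat_mult mult_ac)
  finally have "real l * real ?N =
      real l * (real ?c * real ?L ^ (CARD('k) - 1) / (\<Prod>i\<in>UNIV. real (g i)))"
    by (simp only: mult.assoc times_divide_eq_right)
  then have "real ?N = real ?c * real ?L ^ (CARD('k) - 1) / (\<Prod>i\<in>UNIV. real (g i))"
    using lc(1) by (metis mult_left_cancel of_nat_eq_0_iff less_irrefl)
  with card_residue_class_const[OF assms] show ?thesis by simp
qed

section \<open>Counting factorizations\<close>

text \<open>Coordinatewise division with remainder is a bijection from factorizations to pairs of a
  remainder vector \<open>r\<close> and a quotient vector \<open>q\<close> of prescribed
  sum.\<close>

lemma card_factorizations_eq_sum: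
  assumes n: "CARD('k) * Lcm (range g) \<le> n"
  shows "card (factorizations g n) =
    (\<Sum>r\<in>residue_class g n. card {q :: 'k \<Rightarrow> nat. (\<Sum>i\<in>UNIV. q i) = (n - fact_hom g r) div Lcm (range g)})"
proof -
  let ?L = "Lcm (range g)" and ?M = "\<lambda>i. Lcm (range g) div g i"
  let ?Q = "\<lambda>m. {q :: 'k \<Rightarrow> nat. (\<Sum>i\<in>UNIV. q i) = m}"
  \<comment> \<open>Vectors of sum m are the factorizations of m when every generator is 1.\<close>
  have finQ: "finite (?Q m)" for m
    using finite_factorizations[of "\<lambda>_ :: 'k. 1" m] by (simp add: factorizations_def fact_hom_def)
  define D where "D = Sigma (residue_class g n) (\<lambda>r. ?Q ((n - fact_hom g r) div ?L))"
  have "bij_betw (\<lambda>(r, q) i. q i * ?M i + r i) D (factorizations g n)"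
  proof (rule bij_betw_byWitness[where f' = "\<lambda>z. (\<lambda>i. z i mod ?M i, \<lambda>i. z i div ?M i)"])
    show "\<forall>x\<in>D. (case (case x of (r, q) \<Rightarrow> \<lambda>i. q i * ?M i + r i) of z \<Rightarrow>
        (\<lambda>i. z i mod ?M i, \<lambda>i. z i div ?M i)) = x"
      using div_gen_pos by (auto simp: D_def residue_class_def residue_box_def fun_eq_iff)
    show "\<forall>z\<in>factorizations g n.
        (case (\<lambda>i. z i mod ?M i, \<lambda>i. z i div ?M i) of (r, q) \<Rightarrow> \<lambda>i. q i * ?M i + r i) = z"
      unfolding prod.case by (intro ballI ext) (rule div_mult_mod_eq)
    show "(\<lambda>(r, q) i. q i * ?M i + r i) ` D \<subseteq> factorizations g n"
    proof clarify
      fix r q assume rq: "(r, q) \<in> D"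
      then have r: "r \<in> residue_box g" "[fact_hom g r = n] (mod ?L)"
        and q: "(\<Sum>i\<in>UNIV. q i) = (n - fact_hom g r) div ?L"
        by (auto simp: D_def residue_class_def)
      \<comment> \<open>The lower bound on n enters here: with \<phi>(r) > n, truncated subtraction
        would admit the spurious quotient q = 0.\<close>
      have le: "fact_hom g r \<le> n" using fact_hom_residue_box_le[OF r(1)] n by linarith
      then have "?L dvd n - fact_hom g r" using r(2) by (metis cong_altdef_nat cong_sym)
      then have "?L * (\<Sum>i\<in>UNIV. q i) = n - fact_hom g r" using q by simp
      then show "(\<lambda>i. q i * ?M i + r i) \<in> factorizations g n"
        using le by (simp add: factorizations_def fact_hom_div_mod)
    qed
    show "(\<lambda>z. (\<lambda>i. z i mod ?M i, \<lambda>i. z i div ?M i)) ` factorizations g n \<subseteq> D"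
    proof
      fix x assume "x \<in> (\<lambda>z. (\<lambda>i. z i mod ?M i, \<lambda>i. z i div ?M i)) ` factorizations g n"
      then obtain z where z: "fact_hom g z = n" and x: "x = (\<lambda>i. z i mod ?M i, \<lambda>i. z i div ?M i)"
        by (auto simp: factorizations_def)
      have eq: "n = ?L * (\<Sum>i\<in>UNIV. z i div ?M i) + fact_hom g (\<lambda>i. z i mod ?M i)"
        using fact_hom_div_mod[of "\<lambda>i. z i div ?M i" "\<lambda>i. z i mod ?M i"] z
        by (simp only: div_mult_mod_eq)
      have "(n - s) div l = q \<and> [s = n] (mod l)" if "n = l * q + s" "0 < l" for n l q s :: nat
        using that by (simp add: cong_def)
      from this[OF eq Lcm_pos] show "x \<in> D"
        using div_gen_pos by (simp add: x D_def residue_class_def residue_box_def)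
    qed
  qed
  then have "card (factorizations g n) = card D" by (simp add: bij_betw_same_card)
  also have "\<dots> = (\<Sum>r\<in>residue_class g n. card (?Q ((n - fact_hom g r) div ?L)))"
    unfolding D_def using finQ by (subst card_SigmaI) auto
  finally show ?thesis .
qed

end

section \<open>Compositions and binomial polynomials\<close>

text \<open>Stars and bars: listing the index type turns vectors into lists of length k with sum m,
  whose number is known.\<close>

lemma card_compositions:
  "card {q :: 'k::finite \<Rightarrow> nat. (\<Sum>i\<in>UNIV. q i) = m} = (m + CARD('k) - 1) choose m"
proof -
  obtain xs :: "'k list" where xs: "set xs = UNIV" "distinct xs"
    using finite_distinct_list[OF finite] by blast
  have len: "length xs = CARD('k)" using xs distinct_card by fastforce
  have "bij_betw (\<lambda>q. map q xs) {q :: 'k \<Rightarrow> nat. (\<Sum>i\<in>UNIV. q i) = m}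
      {l. length l = CARD('k) \<and> sum_list l = m}"
    unfolding bij_betw_def
  proof
    show "inj_on (\<lambda>q. map q xs) {q :: 'k \<Rightarrow> nat. (\<Sum>i\<in>UNIV. q i) = m}"
      using xs(1) by (auto simp: inj_on_def)
    have sum: "sum_list (map q xs) = (\<Sum>i\<in>UNIV. q i)" for q :: "'k \<Rightarrow> nat"
      using xs by (simp add: sum_list_distinct_conv_sum_set)
    have "l \<in> (\<lambda>q. map q xs) ` {q. (\<Sum>i\<in>UNIV. q i) = m}"
      if "length l = CARD('k)" "sum_list l = m" for l
    proof -
      \<comment> \<open>The preimage of \<open>l\<close> assigns to each index the entry of
        \<open>l\<close> at that index's position in \<open>xs\<close>.\<close>
      have "l = map (the \<circ> map_of (zip xs l)) xs"
        using that len xs(2) by (intro nth_equalityI) (auto simp: map_of_zip_nth)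
      then show ?thesis using that(2) sum by (metis (mono_tags, lifting) image_eqI mem_Collect_eq)
    qed
    then show "(\<lambda>q. map q xs) ` {q. (\<Sum>i\<in>UNIV. q i) = m} =
        {l. length l = CARD('k) \<and> sum_list l = m}"
      using len sum by auto
  qed
  then show ?thesis using card_length_sum_list[of "CARD('k)" m] by (simp add: bij_betw_same_card)
qed

text \<open>The polynomial \<open>((x - s) / L + d choose d)\<close> in \<open>x\<close>.\<close>

definition shifted_binomial :: "nat \<Rightarrow> nat \<Rightarrow> nat \<Rightarrow> real poly" where
  "shifted_binomial d L s =
    smult (1 / fact d) (\<Prod>j<d. [:real (Suc j) - real s / real L, 1 / real L:])"

text \<open>Each of the d linear factors has leading coefficient 1/L. The result is independent of
  \<open>s\<close>, so all remainders and trades contribute equally to the leading term.\<close>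

lemma coeff_shifted_binomial:
  assumes "0 < L"
  shows "coeff (shifted_binomial d L s) d = 1 / (fact d * real L ^ d)"
proof -
  let ?P = "\<lambda>d. \<Prod>j<d. [:real (Suc j) - real s / real L, 1 / real L:]"
  have "degree (?P d) = d" using assms by (subst degree_prod_eq_sum_degree) auto
  moreover have "lead_coeff (?P d) = (1 / real L) ^ d"
    using assms by (subst lead_coeff_prod) auto
  ultimately show ?thesis by (simp add: shifted_binomial_def power_divide)
qed

lemma degree_shifted_binomial: "degree (shifted_binomial d L s) \<le> d"
proof -
  have "degree (\<Prod>j<d. [:real (Suc j) - real s / real L, 1 / real L:]) \<le> (\<Sum>j<d. 1)"
    by (rule order_trans[OF degree_prod_sum_le]) (auto intro!: sum_mono)
  then show ?thesis by (simp add: shifted_binomial_def)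
qed

text \<open>At L m + s the factor with index j takes the value m + 1 + j, so the product is the
  rising factorial (m + d)! / m!.\<close>

lemma poly_shifted_binomial:
  assumes "0 < L" "n = L * m + s"
  shows "poly (shifted_binomial d L s) (real n) = real ((m + d) choose m)"
proof -
  have "poly [:real (Suc j) - real s / real L, 1 / real L:] (real n) = real (m + 1) + real j" for j
    using assms by (simp add: field_simps)
  then have "poly (shifted_binomial d L s) (real n) = pochhammer (real (m + 1)) d / fact d"
    by (simp only: shifted_binomial_def poly_smult poly_prod pochhammer_prod lessThan_atLeast0) simp
  also have "pochhammer (real (m + 1)) d = fact (m + d) / fact m"
    using pochhammer_product'[of "1::real" m d] by (simp add: pochhammer_fact[symmetric] add_ac)
  finally show ?thesis by (simp add: binomial_fact)
qed

text \<open>The shift by \<open>b\<close> is absorbed into the parameter of the polynomial, which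
  keeps n itself as the variable and lets the coefficients of different trades be added.\<close>

lemma card_factorizations_shift:
  fixes g :: "'k::finite \<Rightarrow> nat"
  assumes pos: "\<And>i. 0 < g i" and n: "CARD('k) * Lcm (range g) + b \<le> n"
  shows "real (card (factorizations g (n - b))) =
    (\<Sum>r\<in>residue_class g (n - b).
      poly (shifted_binomial (CARD('k) - 1) (Lcm (range g)) (fact_hom g r + b)) (real n))"
proof -
  let ?L = "Lcm (range g)"
  have "real (card {q :: 'k \<Rightarrow> nat. (\<Sum>i\<in>UNIV. q i) = (n - b - fact_hom g r) div ?L}) =
      poly (shifted_binomial (CARD('k) - 1) ?L (fact_hom g r + b)) (real n)"
    if r: "r \<in> residue_class g (n - b)" for r
  proof -
    let ?m = "(n - b - fact_hom g r) div ?L"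
    have "fact_hom g r \<le> CARD('k) * ?L"
      using fact_hom_residue_box_le[where g = g, OF pos] r by (simp add: residue_class_def)
    then have le: "fact_hom g r \<le> n - b" using n by linarith
    then have "?L dvd n - b - fact_hom g r"
      using r unfolding residue_class_def by (metis (mono_tags, lifting) mem_Collect_eq cong_altdef_nat cong_sym)
    then have "?L * ?m = n - b - fact_hom g r" by simp
    then have "n = ?L * ?m + (fact_hom g r + b)" using le n by linarith
    from poly_shifted_binomial[OF Lcm_pos[OF pos] this]
    have "poly (shifted_binomial (CARD('k) - 1) ?L (fact_hom g r + b)) (real n) =
      real ((?m + (CARD('k) - 1)) choose ?m)" .
    moreover have "?m + (CARD('k) - 1) = ?m + CARD('k) - 1"
      using zero_less_card_finite[where 'a = 'k] by simp
    ultimately show ?thesis by (simp only: card_compositions)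
  qed
  moreover have "CARD('k) * ?L \<le> n - b" using n by linarith
  ultimately show ?thesis by (simp add: card_factorizations_eq_sum[OF pos])
qed

section \<open>Quasipolynomials\<close>

text \<open>With p the least common period, L mod p is again a shift preserving all coefficients;
  being smaller than p, it must be 0.\<close>

lemma quasipolynomial_period_dvd:
  assumes "0 < L" "\<And>i n. i \<le> d \<Longrightarrow> a i (n + L) = a i n"
  shows "quasipolynomial_period d a dvd L"
proof -
  let ?P = "\<lambda>p. 0 < p \<and> (\<forall>i\<le>d. \<forall>n. a i (n + p) = a i n)"
  define p where "p = quasipolynomial_period d a"
  have p: "?P p" unfolding p_def quasipolynomial_period_def by (rule LeastI[of ?P L]) (use assms in auto)
  have mult: "a i (n + j * p) = a i n" if "i \<le> d" for i n j
  proof (induction j)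
    case (Suc j)
    have "a i (n + Suc j * p) = a i ((n + j * p) + p)" by (simp add: algebra_simps)
    with Suc p that show ?case by metis
  qed simp
  have "a i (n + L mod p) = a i n" if "i \<le> d" for i n
  proof -
    have "a i (n + L mod p) = a i ((n + L mod p) + (L div p) * p)" by (rule mult[OF that, symmetric])
    also have "(n + L mod p) + (L div p) * p = n + L" by simp
    also have "a i (n + L) = a i n" using assms(2)[OF that] .
    finally show ?thesis .
  qed
  moreover have "L mod p < p" using p by simp
  ultimately have "L mod p = 0"
    using not_less_Least[of "L mod p" ?P] unfolding p_def quasipolynomial_period_def by auto
  then show ?thesis unfolding p_def by auto
qed

text \<open>The asymptotic part is restricted to k \<ge> 2: for k = 1 factorizations are unique, so
  an irredundant \<rho> is empty, there are no edges, and degree 0 would require a nonzero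
  coefficient.\<close>

theorem theorem3p9:
  fixes g :: "'k::finite \<Rightarrow> nat" and \<rho> :: "'k trade set"
  assumes "\<And>i. 0 < g i"
    and "minimal_generators g"
    and "finite \<rho>"
    and "presentation g \<rho>"
    and "irredundant_trades \<rho>"
  shows "(\<forall>n\<in>num_semigroup g. (\<forall>(t, t')\<in>\<rho>. fact_hom g t \<le> n) \<longrightarrow>
           card (edges (trade_graph g \<rho> n)) =
             (\<Sum>(t, t')\<in>\<rho>. card (factorizations g (n - fact_hom g t)))) \<and>
         (2 \<le> CARD('k) \<longrightarrow>
           (\<exists>f a. quasipolynomial f (CARD('k) - 1) a \<and>
             (\<exists>N. \<forall>n\<ge>N. real (card (edges (trade_graph g \<rho> n))) = f n) \<and>
             (\<forall>n. Gcd (range g) dvd n \<longrightarrow>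
                a (CARD('k) - 1) n =
                  real (Gcd (range g)) * real (card \<rho>) /
                    (fact (CARD('k) - 1) * (\<Prod>i\<in>UNIV. real (g i)))) \<and>
             quasipolynomial_period (CARD('k) - 1) a dvd Lcm (range g)))"
proof -
  let ?L = "Lcm (range g)" and ?c = "Gcd (range g)" and ?d = "CARD('k) - 1"
  let ?E = "\<lambda>n. card (edges (trade_graph g \<rho> n))"
  let ?lead = "real ?c * real (card \<rho>) / (fact ?d * (\<Prod>i\<in>UNIV. real (g i)))"
  note pos = assms(1)
  have ker: "\<rho> \<subseteq> fact_kernel g" using assms(4) by (simp add: presentation_def)
  note edge_count = card_edges_trade_graph[OF pos assms(3) ker assms(5)]
  have L: "0 < ?L" by (rule Lcm_pos[OF pos])
  \<comment> \<open>Modulo \<open>L\<close>, \<open>n + (L - 1) * b\<close> stands for \<open>n - b\<close>, also when \<open>n < b\<close>.\<close>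
  define R where "R b n = residue_class g (n + (?L - 1) * b)" for b n
  \<comment> \<open>All polynomials share the variable n, so their coefficients are collected power
    by power; the dependence on n is only through the class \<open>R\<close>, hence through n modulo
    L.\<close>
  define a where "a i n = (\<Sum>(t, t')\<in>\<rho>. \<Sum>r\<in>R (fact_hom g t) n.
    coeff (shifted_binomial ?d ?L (fact_hom g r + fact_hom g t)) i)" for i n
  define f where "f n = (\<Sum>i\<le>?d. a i n * real n ^ i)" for n
  have R_diff: "R b n = residue_class g (n - b)" if "b \<le> n" for b n
  proof -
    have "n + (?L - 1) * b = (n - b) + ?L * b" using that L by (cases ?L) auto
    then show ?thesis unfolding R_def by (intro residue_class_cong[OF pos]) (simp add: cong_def)
  qed
  have per: "a i (n + ?L) = a i n" for i n
  proof -
    have "R b (n + ?L) = R b n" for b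
      unfolding R_def using mod_add_self2[of "n + (?L - 1) * b" ?L]
      by (intro residue_class_cong[OF pos]) (simp add: cong_def add_ac del: mod_add_self2)
    then show ?thesis by (simp add: a_def)
  qed
  \<comment> \<open>For c dividing n, each trade contributes the common class size times the common
    top coefficient, and L^(k-1) cancels.\<close>
  have lead: "a ?d n = ?lead" if n: "?c dvd n" for n
  proof -
    have "real (card (R (fact_hom g t) n)) = real ?c * real ?L ^ ?d / (\<Prod>i\<in>UNIV. real (g i))" for t
      unfolding R_def by (rule card_residue_class[OF pos]) (intro dvd_add dvd_mult n Gcd_dvd_fact_hom)
    then have "a ?d n = (\<Sum>(t, t')\<in>\<rho>. real ?c * real ?L ^ ?d / (\<Prod>i\<in>UNIV. real (g i)) *
        (1 / (fact ?d * real ?L ^ ?d)))"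
      unfolding a_def coeff_shifted_binomial[OF L] by (simp only: sum_constant)
    also have "\<dots> = (\<Sum>(t, t')\<in>\<rho>. real ?c / (fact ?d * (\<Prod>i\<in>UNIV. real (g i))))"
    proof -
      have cancel: "x * l / y * (1 / (z * l)) = x / (z * y)" if "l \<noteq> 0" for x y z l :: real
        using that by simp
      have "real ?L ^ ?d \<noteq> 0" using L by (metis of_nat_eq_0_iff power_not_zero less_irrefl)
      show ?thesis unfolding cancel[OF \<open>real ?L ^ ?d \<noteq> 0\<close>] ..
    qed
    also have "\<dots> = ?lead" by (simp only: case_prod_beta' sum_constant) simp
    finally show ?thesis .
  qed
  have ev: "\<exists>N. \<forall>n\<ge>N. real (?E n) = f n"
  proof (intro exI allI impI)
    \<comment> \<open>The sum of all \<phi>(t) is a convenient upper bound for each of them, so n -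
      \<phi>(t) is at least k L for every trade.\<close>
    let ?N = "CARD('k) * ?L + (\<Sum>(t, t')\<in>\<rho>. fact_hom g t)"
    fix n assume n: "?N \<le> n"
    have bnd: "CARD('k) * ?L + fact_hom g t \<le> n" if "(t, t') \<in> \<rho>" for t t'
    proof -
      have "fact_hom g t \<le> (\<Sum>(t, t')\<in>\<rho>. fact_hom g t)"
        using member_le_sum[OF that, of "\<lambda>(t, t'). fact_hom g t"] assms(3) by auto
      with n show ?thesis by linarith
    qed
    \<comment> \<open>Padding with zero coefficients up to k - 1 gives all these polynomials the
      same range of summation.\<close>
    have poly: "poly (shifted_binomial ?d ?L s) (real n) =
        (\<Sum>i\<le>?d. coeff (shifted_binomial ?d ?L s) i * real n ^ i)" for s
      unfolding poly_altdef using degree_shifted_binomial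
      by (intro sum.mono_neutral_left) (auto simp: coeff_eq_0)
    have "real (?E n) = (\<Sum>(t, t')\<in>\<rho>. real (card (factorizations g (n - fact_hom g t))))"
    proof (subst edge_count)
      show "\<forall>(t, t')\<in>\<rho>. fact_hom g t \<le> n" using bnd by fastforce
    qed (simp add: case_prod_beta')
    also have "\<dots> = (\<Sum>(t, t')\<in>\<rho>. \<Sum>r\<in>R (fact_hom g t) n.
        poly (shifted_binomial ?d ?L (fact_hom g r + fact_hom g t)) (real n))"
    proof (intro sum.cong refl, clarify)
      fix t t' assume "(t, t') \<in> \<rho>"
      note le = bnd[OF this]
      then have R: "R (fact_hom g t) n = residue_class g (n - fact_hom g t)"
        by (intro R_diff) simp
      show "real (card (factorizations g (n - fact_hom g t))) = (\<Sum>r\<in>R (fact_hom g t) n.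
          poly (shifted_binomial ?d ?L (fact_hom g r + fact_hom g t)) (real n))"
        unfolding R by (rule card_factorizations_shift[OF pos le])
    qed
    also have "\<dots> = (\<Sum>x\<in>\<rho>. \<Sum>i\<le>?d. \<Sum>r\<in>R (fact_hom g (fst x)) n.
        coeff (shifted_binomial ?d ?L (fact_hom g r + fact_hom g (fst x))) i * real n ^ i)"
      unfolding poly case_prod_beta by (intro sum.cong refl sum.swap)
    also have "\<dots> = f n"
      unfolding f_def a_def case_prod_beta by (subst sum.swap) (simp add: sum_distrib_right)
    finally show "real (?E n) = f n" .
  qed
  have quasi: "quasipolynomial f ?d a" if "2 \<le> CARD('k)"
  proof -
    have "?c \<noteq> 0" using pos by (metis Gcd_0_iff less_irrefl rangeI singletonD subsetD)
    \<comment> \<open>The argument 0 is divisible by c, so the leading coefficient formula applies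
      there.\<close>
    then have "a ?d 0 \<noteq> 0"
      using lead[of 0] presentation_nonempty[OF pos assms(4) that] assms(3) pos by auto
    then show ?thesis using per L by (auto simp: quasipolynomial_def is_periodic_def f_def)
  qed
  have period: "quasipolynomial_period ?d a dvd ?L"
    using L per by (rule quasipolynomial_period_dvd)
  show ?thesis
  proof (intro conjI ballI impI)
    fix n assume "\<forall>(t, t')\<in>\<rho>. fact_hom g t \<le> n"
    then show "?E n = (\<Sum>(t, t')\<in>\<rho>. card (factorizations g (n - fact_hom g t)))"
      by (rule edge_count)
  next
    assume "2 \<le> CARD('k)"
    then show "\<exists>f a. quasipolynomial f ?d a \<and> (\<exists>N. \<forall>n\<ge>N. real (?E n) = f n) \<and>
        (\<forall>n. ?c dvd n \<longrightarrow> a ?d n = ?lead) \<and> quasipolynomial_period ?d a dvd ?L"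
      using quasi ev lead period by (intro exI[of _ f] exI[of _ a] conjI allI impI) simp_all
  qed
qed

end
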